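(* Let $c:\mathbb{Z}^d\to\mathbb{Z}$ be a sparse configuration and assume $\varphi_1\cdots\varphi_n c=0$ where $\varphi_1,\ldots,\varphi_n$ are line polynomials in pairwise non-parallel directions $\mathbf v_1,\ldots,\mathbf v_n$, respectively. Then $c=c_1+\cdots+c_n$ where, for each $i$, $c_i$ is a sum of finitely many periodic $\mathbf v_i$-fibers and $\varphi_ic_i=0$.
   Context: A configuration is a function $\mathbb{Z}^d\to\mathbb{Z}$ with finitely many values. Functions are identified with formal power series $\sum_{\mathbf u}c(\mathbf u)X^{\mathbf u}$. "Polynomial" means a Laurent polynomial $f=\sum_if_iX^{\mathbf u_i}$ with integer coefficients; $fc$ is $\mathbf u\mapsto\sum_if_ic(\mathbf u-\mathbf u_i)$. A line polynomial in direction $\mathbf v\in\mathbb{Z}^d\setminus\{\vec0\}$ is a polynomial whose support $\{\mathbf u:f_{\mathbf u}\ne0\}$ has at least two points and is contained in $\mathbf u+\mathbb{Q}\mathbf v$ for some $\mathbf u\in\mathbb{Z}^d$; vectors are parallel if linearly dependent over $\mathbb{Q}$. With $\mathrm{supp}(c)=\{\mathbf u:c(\mathbf u)\ne0\}$ and $C_m=\{-m,\ldots,m\}^d$, $c$ is sparse if there is a positive integer $a$ with $|\mathrm{supp}(c)\cap(C_m+\mathbf t)|\le am$ for all $m\in\mathbb{Z}_+$, $\mathbf t\in\mathbb{Z}^d$. For nonzero $\mathbf v\in\mathbb{Q}^d$, a function $e$ is a $\mathbf v$-fiber if $\mathrm{supp}(e)\subseteq\mathbf u+\mathbb{Q}\mathbf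 v$ for some $\mathbf u\in\mathbb{Z}^d$; it is periodic if $e(\mathbf u+\mathbf w)=e(\mathbf u)$ for all $\mathbf u$ for some nonzero $\mathbf w\in\mathbb{Z}^d$. *)

theory Defs
  imports "HOL-Analysis.Finite_Cartesian_Product" "HOL-Analysis.Cartesian_Space" "HOL-Library.Poly_Mapping"
begin

text \<open>
  Laurent polynomials in \<open>X = (x\<^sub>1, \<dots>, x\<^sub>d)\<close> with integer coefficients are the finitely supported
  maps from exponent vectors in \<open>\<int>\<^sup>d\<close> to \<open>\<int>\<close>; the product on \<^typ>\<open>(int ^ 'd) \<Rightarrow>\<^sub>0 int\<close> is convolution.
\<close>

type_synonym 'd laurent = "(int ^ 'd) \<Rightarrow>\<^sub>0 int"

definition configuration :: "(int ^ 'd \<Rightarrow> int) \<Rightarrow> bool" where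
  "configuration c \<longleftrightarrow> finite (range c)"

definition supp :: "(int ^ 'd \<Rightarrow> int) \<Rightarrow> (int ^ 'd) set" where
  "supp c = {u. c u \<noteq> 0}"

definition act :: "'d::finite laurent \<Rightarrow> (int ^ 'd \<Rightarrow> int) \<Rightarrow> (int ^ 'd \<Rightarrow> int)" where
  "act f c = (\<lambda>u. \<Sum>w\<in>Poly_Mapping.keys f. Poly_Mapping.lookup f w * c (u - w))"

definition rat_vec :: "int ^ 'd \<Rightarrow> rat ^ 'd" where
  "rat_vec u = (\<chi> i. of_int (u $ i))"

text \<open>The integer points of the rational line \<open>u + \<rat>v\<close>.\<close>

definition line :: "int ^ 'd \<Rightarrow> rat ^ 'd \<Rightarrow> (int ^ 'd) set" where
  "line u v = {w. \<exists>q::rat. rat_vec w = rat_vec u + q *s v}"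

definition line_polynomial :: "int ^ 'd \<Rightarrow> 'd::finite laurent \<Rightarrow> bool" where
  "line_polynomial v f \<longleftrightarrow>
     v \<noteq> 0 \<and> card (Poly_Mapping.keys f) \<ge> 2 \<and> (\<exists>u. Poly_Mapping.keys f \<subseteq> line u (rat_vec v))"

text \<open>
  Linear dependence of the pair \<open>(v, w)\<close>. Dependence of the set \<open>{v, w}\<close> would be wrong here,
  since that set is independent when \<open>v = w \<noteq> 0\<close>.
\<close>

definition parallel :: "int ^ 'd \<Rightarrow> int ^ 'd \<Rightarrow> bool" where
  "parallel v w \<longleftrightarrow>
     (\<exists>a b::rat. (a \<noteq> 0 \<or> b \<noteq> 0) \<and> a *s rat_vec v + b *s rat_vec w = 0)"

definition cube :: "nat \<Rightarrow> (int ^ 'd) set" where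
  "cube m = {u. \<forall>i. u $ i \<in> {- int m..int m}}"

definition sparse :: "(int ^ 'd::finite \<Rightarrow> int) \<Rightarrow> bool" where
  "sparse c \<longleftrightarrow>
     (\<exists>a::nat. a > 0 \<and>
       (\<forall>m::nat. m > 0 \<longrightarrow> (\<forall>t. card (supp c \<inter> (\<lambda>u. u + t) ` cube m) \<le> a * m)))"

definition fiber :: "rat ^ 'd \<Rightarrow> (int ^ 'd \<Rightarrow> int) \<Rightarrow> bool" where
  "fiber v e \<longleftrightarrow> v \<noteq> 0 \<and> (\<exists>u. supp e \<subseteq> line u v)"

definition periodic :: "(int ^ 'd::finite \<Rightarrow> int) \<Rightarrow> bool" where
  "periodic e \<longleftrightarrow> (\<exists>w. w \<noteq> 0 \<and> (\<forall>u. e (u + w) = e u))"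

definition finite_sum_of_periodic_fibers :: "rat ^ 'd::finite \<Rightarrow> (int ^ 'd \<Rightarrow> int) \<Rightarrow> bool" where
  "finite_sum_of_periodic_fibers v c \<longleftrightarrow>
     (\<exists>(k::nat) e. (\<forall>j<k. fiber v (e j) \<and> periodic (e j)) \<and> c = (\<lambda>u. \<Sum>j<k. e j u))"

end

(* The values of c along a v_i-line satisfy the recurrence phi_i up to the term phi_i c, which by
   induction on the number of factors lives on finitely many v_j-lines with j different from i, so
   meets each v_i-line in finitely many points. Finiteness of the range then makes c eventually
   periodic towards either end of each v_i-line, and sparseness leaves only finitely many v_i-lines
   with a nonzero end. The periodic continuations of the right ends and of the left ends coincide,
   because both have the same image as c under the product of the other factors. Subtracting these
   continuations for all i leaves a function with finite support on every v_i-line, and such a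
   function is zero as soon as the product of the phi_i annihilates it. *)
theory Submission
  imports Defs
begin

section \<open>The action of Laurent polynomials on functions\<close>

lemma act_superset:
  assumes "finite A" "Poly_Mapping.keys f \<subseteq> A"
  shows "act f c u = (\<Sum>w\<in>A. Poly_Mapping.lookup f w * c (u - w))"
  unfolding act_def by (rule sum.mono_neutral_left) (use assms in \<open>auto simp: in_keys_iff\<close>)

lemma act_add_left: "act (f + g) c = (\<lambda>u. act f c u + act g c u)"
proof
  fix u
  let ?A = "Poly_Mapping.keys f \<union> Poly_Mapping.keys g"
  show "act (f + g) c u = act f c u + act g c u"
    using keys_add[of f g]
    by (simp add: act_superset[of ?A] lookup_add sum.distrib distrib_right)
qed

lemma act_single: "act (Poly_Mapping.single w a) c = (\<lambda>u. a * c (u - w))"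
  by (simp add: act_def)

lemma act_one [simp]: "act 1 c = c"
  by (simp add: act_single flip: single_one)

lemma act_zero_left [simp]: "act 0 c = (\<lambda>_. 0)"
  by (simp add: act_def)

lemma act_zero [simp]: "act f (\<lambda>_. 0) = (\<lambda>_. 0)"
  by (simp add: act_def)

lemma act_diff: "act f (\<lambda>u. c u - e u) = (\<lambda>u. act f c u - act f e u)"
  by (simp add: act_def right_diff_distrib sum_subtractf)

lemma act_sum: "act f (\<lambda>u. \<Sum>i\<in>I. c i u) = (\<lambda>u. \<Sum>i\<in>I. act f (c i) u)"
  unfolding act_def sum_distrib_left by (rule ext, rule sum.swap)


text \<open>Builds a finitely supported map one monomial at a time, so that \<open>act_mult\<close>
  only has to be checked on monomials. It follows from induction on updates: the updated key is new,
  so updating is the same as adding a monomial.\<close>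

lemma poly_mapping_add_induct [case_names zero add]:
  assumes "P 0" "\<And>f w a. P f \<Longrightarrow> P (Poly_Mapping.single w a + f)"
  shows "P (f :: 'a \<Rightarrow>\<^sub>0 int)"
proof (induction f rule: update_induct)
  case const
  then show ?case using assms(1) by simp
next
  case (update f a b)
  then have "Poly_Mapping.update a b f = Poly_Mapping.single a b + f"
    by (intro poly_mapping_eqI) (auto simp: lookup_update lookup_add lookup_single in_keys_iff)
  with update assms(2) show ?case by simp
qed

lemma act_mult: "act (f * g) c = act f (act g c)"
proof (induction f rule: poly_mapping_add_induct)
  case (add f w a)
  have "act (Poly_Mapping.single w a * g) c = (\<lambda>u. a * act g c (u - w))"
  proof (induction g rule: poly_mapping_add_induct)
    case (add g x b)
    then show ?case
      by (simp add: distrib_left act_add_left act_single mult_single algebra_simps)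
  qed simp
  with add show ?case
    by (simp add: distrib_right act_add_left act_single)
qed simp

lemma act_prod_split:
  assumes "finite I" "i \<in> I"
  shows "act (\<Prod>j\<in>I. f j) c = act (\<Prod>j\<in>I - {i}. f j) (act (f i) c)"
  by (simp add: act_mult[symmetric] prod.remove[OF assms] mult.commute)

section \<open>Stability of configurations and of sparseness under the action\<close>

text \<open>The value at \<open>u\<close> depends only on the pattern of values
  \<open>c (u - w)\<close> for \<open>w\<close> in the keys of \<open>f\<close>, and a finite range
  admits only finitely many such patterns.\<close>

lemma configuration_act:
  assumes "configuration c"
  shows "configuration (act f c)"
proof -
  let ?K = "Poly_Mapping.keys f"
  have "range (act f c) \<subseteq> (\<lambda>g. \<Sum>w\<in>?K. Poly_Mapping.lookup f w * g w) ` (?K \<rightarrow>\<^sub>E range c)"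
  proof
    fix y assume "y \<in> range (act f c)"
    then obtain u where "y = act f c u" by blast
    then have "y = (\<Sum>w\<in>?K. Poly_Mapping.lookup f w * restrict (\<lambda>w. c (u - w)) ?K w)"
      by (simp add: act_def)
    then show "y \<in> (\<lambda>g. \<Sum>w\<in>?K. Poly_Mapping.lookup f w * g w) ` (?K \<rightarrow>\<^sub>E range c)"
      by (intro image_eqI[where x = "restrict (\<lambda>w. c (u - w)) ?K"]) auto
  qed
  moreover have "finite (?K \<rightarrow>\<^sub>E range c)"
    using assms by (intro finite_PiE) (auto simp: configuration_def)
  ultimately show ?thesis
    unfolding configuration_def by (meson finite_imageI finite_subset)
qed

lemma finite_cube: "finite (cube m :: (int ^ 'd::finite) set)"
proof (rule finite_subset)
  show "(cube m :: (int ^ 'd) set) \<subseteq> vec_lambda ` (UNIV \<rightarrow>\<^sub>E {- int m..int m})"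
  proof
    fix u :: "int ^ 'd" assume "u \<in> cube m"
    then show "u \<in> vec_lambda ` (UNIV \<rightarrow>\<^sub>E {- int m..int m})"
      by (intro image_eqI[of _ _ "vec_nth u"]) (auto simp: cube_def)
  qed
qed (simp add: finite_PiE)

text \<open>The support of \<open>act f c\<close> is covered by the translates of
  \<open>supp c\<close> by the keys of \<open>f\<close>, and each translate obeys the bound of
  \<open>c\<close> because the cubes may be placed anywhere. The extra 1 keeps the constant positive
  when \<open>f\<close> has no keys.\<close>

lemma sparse_act:
  assumes "sparse c"
  shows "sparse (act f c)"
proof -
  obtain a where "a > 0" and a: "\<And>m t. m > 0 \<Longrightarrow> card (supp c \<inter> (\<lambda>u. u + t) ` cube m) \<le> a * m"
    using assms unfolding sparse_def by blast
  let ?K = "Poly_Mapping.keys f"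
  have "card (supp (act f c) \<inter> (\<lambda>u. u + t) ` cube m) \<le> (card ?K * a + 1) * m" if "m > 0" for m t
  proof -
    let ?S = "\<lambda>w. supp c \<inter> (\<lambda>u. u + (t - w)) ` cube m"
    have "supp (act f c) \<inter> (\<lambda>u. u + t) ` cube m \<subseteq> (\<Union>w\<in>?K. (\<lambda>u. u + w) ` ?S w)"
    proof
      fix x assume x: "x \<in> supp (act f c) \<inter> (\<lambda>u. u + t) ` cube m"
      then have "\<exists>w\<in>?K. Poly_Mapping.lookup f w * c (x - w) \<noteq> 0"
        unfolding supp_def act_def by (auto intro: ccontr sum.neutral)
      then obtain w where w: "w \<in> ?K" "c (x - w) \<noteq> 0" by auto
      from x obtain u where u: "u \<in> cube m" "x = u + t" by blast
      have "x - w \<in> ?S w"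
        using u w by (auto simp: supp_def algebra_simps)
      then have "x \<in> (\<lambda>u. u + w) ` ?S w"
        by (intro image_eqI[of _ _ "x - w"]) simp_all
      with w show "x \<in> (\<Union>w\<in>?K. (\<lambda>u. u + w) ` ?S w)" by blast
    qed
    then have "card (supp (act f c) \<inter> (\<lambda>u. u + t) ` cube m) \<le> card (\<Union>w\<in>?K. (\<lambda>u. u + w) ` ?S w)"
      by (intro card_mono) (auto simp: finite_cube)
    also have "\<dots> \<le> (\<Sum>w\<in>?K. card ((\<lambda>u. u + w) ` ?S w))"
      by (rule card_UN_le) simp
    also have "\<dots> \<le> (\<Sum>w\<in>?K. a * m)"
      by (intro sum_mono) (use a[OF that] in \<open>simp add: card_image\<close>)
    also have "\<dots> \<le> (card ?K * a + 1) * m" by simp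
    finally show ?thesis .
  qed
  then show ?thesis
    unfolding sparse_def by (intro exI[of _ "card ?K * a + 1"]) auto
qed

section \<open>Integer lines and one-dimensional recurrences\<close>

lemma rat_vec_inj: "rat_vec x = rat_vec y \<longleftrightarrow> x = y"
  by (simp add: rat_vec_def vec_eq_iff)

text \<open>The generator is \<open>v\<close> divided by the gcd \<open>g\<close> of its entries. If
  \<open>q = a / b\<close> in lowest terms moves \<open>u\<close> to an integer point, then
  \<open>b\<close> divides every entry of \<open>v\<close>, hence divides \<open>g\<close>, and the
  displacement is an integer multiple of \<open>w\<close>.\<close>

lemma line_param:
  fixes v :: "int ^ 'd::finite"
  assumes "v \<noteq> 0"
  obtains w where "w \<noteq> 0" "\<And>u. line u (rat_vec v) = range (\<lambda>k. u + k *s w)"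
proof -
  define g where "g = Gcd (range (($) v))"
  have g0: "g \<noteq> 0"
    using assms by (auto simp: g_def vec_eq_iff)
  have gd: "g dvd v $ i" for i
    by (simp add: g_def)
  define w :: "int ^ 'd" where "w = (\<chi> i. v $ i div g)"
  have v: "v = g *s w"
    using gd by (simp add: w_def vec_eq_iff)
  have "line u (rat_vec v) = range (\<lambda>k. u + k *s w)" for u
  proof (intro set_eqI iffI)
    fix x assume "x \<in> range (\<lambda>k. u + k *s w)"
    then obtain k where k: "x = u + k *s w" by blast
    have "rat_vec x = rat_vec u + (of_int k / of_int g) *s rat_vec v"
      using g0 by (simp add: k v rat_vec_def vec_eq_iff)
    then show "x \<in> line u (rat_vec v)" unfolding line_def by blast
  next
    fix x assume "x \<in> line u (rat_vec v)"
    then obtain q where q: "rat_vec x = rat_vec u + q *s rat_vec v"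
      unfolding line_def by blast
    obtain a b where ab: "q = of_int a / of_int b" "b > 0" "coprime a b"
      by (metis quotient_of_div quotient_of_denom_pos quotient_of_coprime surj_pair)
    have eq: "b * (x $ i - u $ i) = a * v $ i" for i
    proof -
      have "of_int (x $ i) = of_int (u $ i) + q * of_int (v $ i)"
        using q by (simp add: rat_vec_def vec_eq_iff)
      then have "of_int (b * (x $ i - u $ i)) = (of_int (a * v $ i) :: rat)"
        using ab by (simp add: field_simps)
      then show ?thesis by (simp only: of_int_eq_iff)
    qed
    have "b dvd v $ i" for i
      using eq[of i] ab(3) by (metis coprime_commute coprime_dvd_mult_right_iff dvd_triv_left)
    then have "b dvd g"
      unfolding g_def by (auto intro: Gcd_greatest)
    then obtain h where h: "g = b * h" ..
    have "x = u + (a * h) *s w"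
    proof -
      have "b * (x $ i - u $ i) = b * (a * h * w $ i)" for i
        using eq[of i] by (simp add: v h ac_simps)
      then have "x $ i - u $ i = a * h * w $ i" for i
        using ab(2) by (metis less_irrefl mult_cancel_left)
      then show ?thesis
        by (simp add: vec_eq_iff algebra_simps)
    qed
    then show "x \<in> range (\<lambda>k. u + k *s w)" by blast
  qed
  moreover have "w \<noteq> 0" using assms v by auto
  ultimately show ?thesis using that by blast
qed

lemma smult_eq_iff:
  fixes w :: "int ^ 'd::finite"
  assumes "w \<noteq> 0"
  shows "j *s w = k *s w \<longleftrightarrow> j = k"
  using assms by (auto simp: vec_eq_iff)

text \<open>Expresses that \<open>f\<close> is the monomial at \<open>u0\<close> times a
  one-variable polynomial of degree \<open>d\<close> in the monomial at \<open>w\<close>, read off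
  from its action. Of the values involved, \<open>a 0\<close> multiplies the one furthest in
  direction \<open>w\<close> and \<open>a d\<close> the one furthest back, so each of these two can
  be isolated.\<close>

definition recurrence :: "int ^ 'd \<Rightarrow> int ^ 'd::finite \<Rightarrow> nat \<Rightarrow> (nat \<Rightarrow> int) \<Rightarrow> 'd laurent \<Rightarrow> bool" where
  "recurrence w u0 d a f \<longleftrightarrow> a 0 \<noteq> 0 \<and> a d \<noteq> 0 \<and>
     (\<forall>c u. act f c (u + u0) = (\<Sum>k\<le>d. a k * c (u - int k *s w)))"

lemma line_polynomial_recurrence:
  assumes f: "line_polynomial v f" and w: "w \<noteq> 0" "\<And>u. line u (rat_vec v) = range (\<lambda>k. u + k *s w)"
  obtains u0 d a where "recurrence w u0 d a f"
proof -
  obtain u1 where u1: "Poly_Mapping.keys f \<subseteq> range (\<lambda>k. u1 + k *s w)"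
    using f w(2) unfolding line_polynomial_def by auto
  define K where "K = {k. u1 + k *s w \<in> Poly_Mapping.keys f}"
  have K: "Poly_Mapping.keys f = (\<lambda>k. u1 + k *s w) ` K"
    using u1 by (auto simp: K_def)
  have inj: "inj (\<lambda>k. u1 + k *s w)"
    by (rule injI) (simp add: smult_eq_iff[OF w(1)])
  have fin: "finite K"
    using K finite_keys[of f] inj by (metis finite_imageD inj_on_subset top_greatest)
  have ne: "K \<noteq> {}"
    using f K unfolding line_polynomial_def by auto
  \<comment> \<open>Normalising by the least exponent puts \<open>Min K\<close> at index 0 and
    \<open>Max K\<close> at index \<open>d\<close>; both are exponents of \<open>f\<close>, so the
    two end coefficients are nonzero.\<close>
  define k0 where "k0 = Min K"
  define d where "d = nat (Max K - Min K)"
  define u0 where "u0 = u1 + k0 *s w"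
  define a where "a k = Poly_Mapping.lookup f (u0 + int k *s w)" for k
  have le: "Min K \<le> Max K" using fin ne by simp
  have "Min K \<in> K" "Max K \<in> K" using fin ne by auto
  then have "a 0 \<noteq> 0" "a d \<noteq> 0"
    using le by (auto simp: a_def u0_def K_def k0_def d_def in_keys_iff algebra_simps
      simp flip: vector_sadd_rdistrib)
  moreover have "act f c (u + u0) = (\<Sum>k\<le>d. a k * c (u - int k *s w))" for c u
  proof -
    let ?g = "\<lambda>k. u0 + int k *s w"
    have "Poly_Mapping.keys f \<subseteq> ?g ` {..d}"
    proof
      fix x assume "x \<in> Poly_Mapping.keys f"
      then obtain k where k: "k \<in> K" "x = u1 + k *s w" using K by auto
      then have "Min K \<le> k" "k \<le> Max K" using fin by auto
      then have "x = ?g (nat (k - k0))" "nat (k - k0) \<le> d"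
        by (auto simp: k u0_def k0_def d_def algebra_simps simp flip: vector_sadd_rdistrib)
      then show "x \<in> ?g ` {..d}" by blast
    qed
    then have "act f c (u + u0) = (\<Sum>x\<in>?g ` {..d}. Poly_Mapping.lookup f x * c (u + u0 - x))"
      by (intro act_superset) auto
    also have "\<dots> = (\<Sum>k\<le>d. Poly_Mapping.lookup f (?g k) * c (u + u0 - ?g k))"
      by (subst sum.reindex) (auto simp: inj_on_def smult_eq_iff[OF w(1)])
    finally show ?thesis by (simp add: a_def)
  qed
  ultimately show ?thesis using that unfolding recurrence_def by blast
qed

text \<open>Reversing the order of the coefficients reverses the direction, so what is proved for
  the ends in direction \<open>w\<close> also applies to the opposite ends.\<close>

lemma recurrence_uminus:
  assumes "recurrence w u0 d a f"
  shows "recurrence (- w) (u0 + int d *s w) d (\<lambda>k. a (d - k)) f"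
  unfolding recurrence_def
proof (intro conjI allI)
  fix c u
  have "act f c (u + (u0 + int d *s w)) = act f c ((u + int d *s w) + u0)"
    by (simp add: algebra_simps)
  also have "\<dots> = (\<Sum>k\<le>d. a k * c (u + int d *s w - int k *s w))"
    using assms by (simp only: recurrence_def)
  also have "\<dots> = (\<Sum>k\<le>d. a (d - k) * c (u + int d *s w - int (d - k) *s w))"
    by (rule sum.reindex_bij_witness[of _ "\<lambda>k. d - k" "\<lambda>k. d - k"]) auto
  also have "\<dots> = (\<Sum>k\<le>d. a (d - k) * c (u - int k *s (- w)))"
    by (intro sum.cong refl arg_cong2[where f = "(*)"] arg_cong[where f = c])
      (auto simp: vec_eq_iff algebra_simps)
  finally show "act f c (u + (u0 + int d *s w)) = (\<Sum>k\<le>d. a (d - k) * c (u - int k *s (- w)))" .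
qed (use assms in \<open>auto simp: recurrence_def\<close>)

section \<open>Functions that vanish far out in one direction\<close>

text \<open>The point from which \<open>e\<close> vanishes may vary with \<open>u\<close>. The
  notion is one-sided; the opposite ends are reached with \<open>- w\<close>.\<close>

definition ev_zero :: "int ^ 'd \<Rightarrow> (int ^ 'd::finite \<Rightarrow> int) \<Rightarrow> bool" where
  "ev_zero w e \<longleftrightarrow> (\<forall>u. \<forall>\<^sub>F k in sequentially. e (u + int k *s w) = 0)"

lemma ev_zero_act:
  assumes "ev_zero w e"
  shows "ev_zero w (act f e)"
  unfolding ev_zero_def
proof
  fix u
  have "\<forall>\<^sub>F k in sequentially. \<forall>x\<in>Poly_Mapping.keys f. e (u - x + int k *s w) = 0"
    using assms by (intro eventually_ball_finite) (auto simp: ev_zero_def)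
  then show "\<forall>\<^sub>F k in sequentially. act f e (u + int k *s w) = 0"
    by eventually_elim (simp add: act_def algebra_simps)
qed

text \<open>A function that vanishes far out has a last nonzero value on a ray where it is not zero,
  and the recurrence placed \<open>d\<close> steps beyond leaves nothing to cancel that
  value.\<close>

lemma ev_zero_annihilated:
  assumes r: "recurrence w u0 d a f" and z: "act f e = (\<lambda>_. 0)" and ev: "ev_zero w e"
  shows "e = (\<lambda>_. 0)"
proof (rule ccontr)
  assume "e \<noteq> (\<lambda>_. 0)"
  then obtain u where u: "e u \<noteq> 0" by blast
  define S where "S = {k. e (u + int k *s w) \<noteq> 0}"
  obtain N where "\<And>k. k \<ge> N \<Longrightarrow> e (u + int k *s w) = 0"
    using ev unfolding ev_zero_def eventually_sequentially by blast
  then have "S \<subseteq> {..<N}"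
    unfolding S_def by (auto simp: not_le[symmetric])
  then have fin: "finite S" by (rule finite_subset) simp
  have "0 \<in> S" using u by (simp add: S_def)
  define m where "m = Max S"
  have "m \<in> S" unfolding m_def using fin \<open>0 \<in> S\<close> by (intro Max_in) auto
  have big: "e (u + int k *s w) = 0" if "k > m" for k
    using that Max_ge[OF fin, of k] by (force simp: m_def S_def)
  \<comment> \<open>At \<open>m + d\<close> the terms with \<open>k < d\<close> look beyond
    \<open>m\<close> and vanish; only \<open>a d\<close> times the value at \<open>m\<close>
    survives.\<close>
  have "0 = act f e (u + int (m + d) *s w + u0)"
    by (simp add: z)
  also have "\<dots> = (\<Sum>k\<le>d. a k * e (u + int (m + d) *s w - int k *s w))"
    using r by (simp only: recurrence_def)
  also have "\<dots> = (\<Sum>k\<le>d. a k * e (u + int (m + d - k) *s w))"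
    by (intro sum.cong refl arg_cong2[where f = "(*)"] arg_cong[where f = e])
      (auto simp: vec_eq_iff of_nat_diff algebra_simps)
  also have "\<dots> = (\<Sum>k\<in>{d}. a k * e (u + int (m + d - k) *s w))"
    by (rule sum.mono_neutral_right) (auto simp del: of_nat_add of_nat_diff intro!: big)
  finally show False
    using r \<open>m \<in> S\<close> by (auto simp: recurrence_def S_def)
qed

section \<open>Eventual periodicity of recurrent sequences with finitely many values\<close>

text \<open>As \<open>a 0\<close> can be cancelled, each value is determined by the \<open>d\<close>
  preceding ones. Agreement of the sequence with its shift by \<open>t\<close> on one window of
  length \<open>d\<close> therefore propagates forward.\<close>

lemma linear_recurrence_periodic:
  fixes a :: "nat \<Rightarrow> int" and s :: "nat \<Rightarrow> int"
  assumes a0: "a 0 \<noteq> 0" and rec: "\<And>n. n \<ge> N \<Longrightarrow> (\<Sum>k\<le>d. a k * s (n + d - k)) = 0"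
    and win: "\<And>k. k < d \<Longrightarrow> s (N + k + t) = s (N + k)" and "n \<ge> N"
  shows "s (n + t) = s n"
  using \<open>n \<ge> N\<close>
proof (induction n rule: less_induct)
  case (less n)
  show ?case
  proof (cases "n < N + d")
    case True
    with less.prems win[of "n - N"] show ?thesis by simp
  next
    case False
    define m where "m = n - d"
    have m: "m \<ge> N" "n = m + d" using False by (auto simp: m_def)
    have split: "(\<Sum>k\<le>d. g k) = g 0 + (\<Sum>k\<in>{1..d}. g k)" for g :: "nat \<Rightarrow> int"
      by (simp add: atMost_atLeast0 sum.atLeast_Suc_atMost)
    have "(\<Sum>k\<in>{1..d}. a k * s (m + t + d - k)) = (\<Sum>k\<in>{1..d}. a k * s (m + d - k))"
    proof (rule sum.cong)
      fix k assume k: "k \<in> {1..d}"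
      then have "s (m + d - k + t) = s (m + d - k)"
        using m by (intro less.IH) auto
      moreover have "m + t + d - k = m + d - k + t" using k by auto
      ultimately show "a k * s (m + t + d - k) = a k * s (m + d - k)" by simp
    qed simp
    moreover have "(\<Sum>k\<le>d. a k * s (m + t + d - k)) = 0" "(\<Sum>k\<le>d. a k * s (m + d - k)) = 0"
      using m by (auto intro: rec)
    ultimately have "a 0 * s (m + t + d) = a 0 * s (m + d)"
      unfolding split diff_zero by linarith
    then show ?thesis using a0 m by (simp add: ac_simps)
  qed
qed

lemma periodic_mult:
  fixes s :: "nat \<Rightarrow> 'a"
  assumes "\<And>n. n \<ge> N \<Longrightarrow> s (n + t) = s n" "n \<ge> N"
  shows "s (n + m * t) = s n"
proof (induction m)
  case (Suc m)
  then show ?case using assms(1)[of "n + m * t"] assms(2) by (simp add: ac_simps)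
qed simp

text \<open>Two of the first \<open>card A ^ d + 1\<close> windows of length \<open>d\<close> coincide, and their distance
  divides \<open>(card A ^ d)!\<close>, which depends only on \<open>A\<close> and \<open>d\<close>.\<close>

lemma uniform_eventual_period:
  fixes a :: "nat \<Rightarrow> int"
  assumes "finite A" "a 0 \<noteq> 0"
  obtains T where "T > 0"
    "\<And>s. range s \<subseteq> A \<Longrightarrow> \<forall>\<^sub>F n in sequentially. (\<Sum>k\<le>d. a k * s (n + d - k)) = 0 \<Longrightarrow>
       \<forall>\<^sub>F n in sequentially. s (n + T) = s n"
proof
  define M where "M = card A ^ d"
  show "fact M > (0::nat)" by simp
  fix s assume s: "range s \<subseteq> A" and "\<forall>\<^sub>F n in sequentially. (\<Sum>k\<le>d. a k * s (n + d - k)) = 0"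
  then obtain N where rec: "\<And>n. n \<ge> N \<Longrightarrow> (\<Sum>k\<le>d. a k * s (n + d - k)) = 0"
    unfolding eventually_sequentially by blast
  define W where "W n = (\<lambda>k\<in>{..<d}. s (N + n + k))" for n
  have "W n \<in> {..<d} \<rightarrow>\<^sub>E A" for n
    unfolding W_def restrict_PiE_iff using s by blast
  then have sub: "W ` {..M} \<subseteq> {..<d} \<rightarrow>\<^sub>E A"
    by blast
  have "card (W ` {..M}) \<le> card ({..<d} \<rightarrow>\<^sub>E A)"
    by (rule card_mono[OF _ sub]) (use \<open>finite A\<close> in \<open>auto intro: finite_PiE\<close>)
  also have "\<dots> < card {..M}"
    by (simp add: card_PiE M_def)
  finally have "\<not> inj_on W {..M}"
    by (auto dest: card_image)
  then obtain i j where ij: "i < j" "j \<le> M" "W i = W j"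
    unfolding inj_on_def by (metis atMost_iff linorder_neqE_nat)
  define t where "t = j - i"
  have per: "s (n + t) = s n" if "n \<ge> N + i" for n
  proof (rule linear_recurrence_periodic[where N = "N + i" and d = d])
    fix k assume "k < d"
    then show "s (N + i + k + t) = s (N + i + k)"
      using fun_cong[OF ij(3), of k] ij(1) by (simp add: W_def t_def ac_simps)
  qed (use assms rec that in auto)
  have "t dvd fact M"
    using ij by (intro dvd_fact) (auto simp: t_def)
  then obtain q where "fact M = q * t"
    by (metis dvd_def mult.commute)
  then have "s (n + fact M) = s n" if "n \<ge> N + i" for n
    using periodic_mult[of "N + i" s t n q] per that by simp
  then show "\<forall>\<^sub>F n in sequentially. s (n + fact M) = s n"
    unfolding eventually_sequentially by blast
qed

section \<open>Sparse functions along parallel progressions\<close>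

text \<open>A density count with a bound that does not depend on \<open>S\<close>. Injectivity says
  that the progressions are disjoint and without repetitions. A stretch of \<open>l\<close> points
  of each fits into a cube of size \<open>l * h x\<close> up to an additive constant, where
  sparseness allows only about \<open>a * l * h x\<close> points, so there are at most
  \<open>a * h x\<close> progressions.\<close>

lemma sparse_progressions:
  fixes c :: "int ^ 'd::finite \<Rightarrow> int"
  assumes "sparse c"
  obtains B :: nat where "\<And>S. finite S \<Longrightarrow> inj_on (\<lambda>(u, m). u + int m *s x) (S \<times> UNIV) \<Longrightarrow>
     (\<And>u. u \<in> S \<Longrightarrow> \<forall>\<^sub>F m in sequentially. c (u + int m *s x) \<noteq> 0) \<Longrightarrow> card S \<le> B"
proof -
  obtain a where "a > 0" and a: "\<And>m t. m > 0 \<Longrightarrow> card (supp c \<inter> (\<lambda>u. u + t) ` cube m) \<le> a * m"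
    using assms unfolding sparse_def by blast
  define h :: "int ^ 'd \<Rightarrow> nat" where "h y = (\<Sum>i\<in>UNIV. nat \<bar>y $ i\<bar>)" for y
  have h: "\<bar>y $ i\<bar> \<le> int (h y)" for y i
  proof -
    have "nat \<bar>y $ i\<bar> \<le> h y" unfolding h_def by (rule member_le_sum) auto
    then show ?thesis by linarith
  qed
  have cube: "u + int m *s x \<in> cube (h u + m * h x)" for u m
  proof -
    have "\<bar>u $ i + int m * x $ i\<bar> \<le> int (h u + m * h x)" for i
    proof -
      have "\<bar>u $ i + int m * x $ i\<bar> \<le> \<bar>u $ i\<bar> + int m * \<bar>x $ i\<bar>"
        by (metis abs_mult abs_of_nat abs_triangle_ineq)
      also have "\<dots> \<le> int (h u) + int m * int (h x)"
        by (intro add_mono h mult_left_mono) auto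
      finally show ?thesis by simp
    qed
    then have "u $ i + int m * x $ i \<in> {- int (h u + m * h x)..int (h u + m * h x)}" for i
      unfolding atLeastAtMost_iff abs_le_iff by (metis minus_le_iff)
    then show ?thesis by (simp add: cube_def)
  qed
  have cube_mono: "cube m \<subseteq> (cube m' :: (int ^ 'd) set)" if "m \<le> m'" for m m'
  proof -
    have "{- int m..int m} \<subseteq> {- int m'..int m'}" using that by auto
    then show ?thesis unfolding cube_def by blast
  qed
  have "card S \<le> a * h x"
    if S: "finite S" and inj: "inj_on (\<lambda>(u, m). u + int m *s x) (S \<times> UNIV)"
      and ev: "\<And>u. u \<in> S \<Longrightarrow> \<forall>\<^sub>F m in sequentially. c (u + int m *s x) \<noteq> 0" for S
  proof (rule ccontr)
    assume "\<not> card S \<le> a * h x"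
    then have big: "card S \<ge> a * h x + 1" by simp
    have "\<forall>\<^sub>F m in sequentially. \<forall>u\<in>S. c (u + int m *s x) \<noteq> 0"
      using S ev by (intro eventually_ball_finite) auto
    then obtain M where M: "\<And>m u. m \<ge> M \<Longrightarrow> u \<in> S \<Longrightarrow> c (u + int m *s x) \<noteq> 0"
      unfolding eventually_sequentially by blast
    \<comment> \<open>\<open>b\<close> absorbs the starting points and the first \<open>M\<close>
      steps, and its 1 makes the cube size positive. Taking \<open>l\<close> larger than
      \<open>a * b\<close> makes \<open>(a * h x + 1) * l\<close> exceed
      \<open>a * (b + l * h x)\<close>.\<close>
    define b where "b = (\<Sum>u\<in>S. h u) + M * h x + 1"
    define l where "l = a * b + 1"
    let ?P = "(\<lambda>(u, m). u + int m *s x) ` (S \<times> {M..<M + l})"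
    have "?P \<subseteq> supp c \<inter> (\<lambda>u. u + 0) ` cube (b + l * h x)"
    proof -
      have "u + int m *s x \<in> supp c \<inter> cube (b + l * h x)" if "u \<in> S" "m \<in> {M..<M + l}" for u m
      proof -
        have "h u \<le> (\<Sum>u\<in>S. h u)" using S that by (intro member_le_sum) auto
        moreover have "m * h x \<le> (M + l) * h x" using that by (intro mult_right_mono) auto
        ultimately have "h u + m * h x \<le> b + l * h x"
          by (simp add: b_def algebra_simps)
        then have "u + int m *s x \<in> cube (b + l * h x)"
          using cube cube_mono by blast
        with M that show ?thesis by (simp add: supp_def)
      qed
      then show ?thesis by auto
    qed
    then have "card ?P \<le> card (supp c \<inter> (\<lambda>u. u + 0) ` cube (b + l * h x))"
      by (intro card_mono) (auto simp: finite_cube)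
    also have "\<dots> \<le> a * (b + l * h x)"
      by (rule a) (simp add: b_def)
    finally have "card (S \<times> {M..<M + l}) \<le> a * (b + l * h x)"
      by (subst (asm) card_image) (rule inj_on_subset[OF inj], auto)
    then have "card S * l \<le> a * (b + l * h x)"
      unfolding card_cartesian_product card_atLeastLessThan add_diff_cancel_left' .
    moreover have "(a * h x + 1) * l \<le> card S * l"
      using big by (rule mult_right_mono) simp
    ultimately have "(a * h x + 1) * l \<le> a * (b + l * h x)"
      by linarith
    then show False by (simp add: l_def algebra_simps)
  qed
  then show ?thesis using that by blast
qed

section \<open>Finite support on each line, and support on finitely many lines\<close>

definition line_finite :: "int ^ 'd \<Rightarrow> (int ^ 'd::finite \<Rightarrow> int) \<Rightarrow> bool" where
  "line_finite v e \<longleftrightarrow> (\<forall>u. finite (supp e \<inter> line u (rat_vec v)))"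

text \<open>Lines are compared as point sets, so support points on a common line count once.\<close>

definition few_lines :: "int ^ 'd \<Rightarrow> (int ^ 'd::finite \<Rightarrow> int) \<Rightarrow> bool" where
  "few_lines v e \<longleftrightarrow> finite ((\<lambda>u. line u (rat_vec v)) ` supp e)"

lemma line_self: "u \<in> line u v"
  unfolding line_def by (auto intro: exI[of _ 0])

lemma line_eqI:
  assumes "x \<in> line u v"
  shows "line x v = line u v"
proof -
  obtain q where q: "rat_vec x = rat_vec u + q *s v"
    using assms unfolding line_def by blast
  have "(\<exists>p. rat_vec y = rat_vec u + q *s v + p *s v) \<longleftrightarrow> (\<exists>p. rat_vec y = rat_vec u + p *s v)" for y
  proof
    assume "\<exists>p. rat_vec y = rat_vec u + q *s v + p *s v"
    then obtain p where "rat_vec y = rat_vec u + q *s v + p *s v" ..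
    then have "rat_vec y = rat_vec u + (q + p) *s v"
      by (simp add: vector_sadd_rdistrib algebra_simps)
    then show "\<exists>p. rat_vec y = rat_vec u + p *s v" ..
  next
    assume "\<exists>p. rat_vec y = rat_vec u + p *s v"
    then obtain p where "rat_vec y = rat_vec u + p *s v" ..
    then have "rat_vec y = rat_vec u + q *s v + (p - q) *s v"
      by (simp add: vector_sub_rdistrib algebra_simps)
    then show "\<exists>p. rat_vec y = rat_vec u + q *s v + p *s v" ..
  qed
  then show ?thesis unfolding line_def q by simp
qed

lemma line_finite_diff:
  assumes "line_finite v e" "line_finite v e'"
  shows "line_finite v (\<lambda>u. e u - e' u)"
  unfolding line_finite_def
proof
  fix u
  have "supp (\<lambda>u. e u - e' u) \<inter> line u (rat_vec v)
      \<subseteq> supp e \<inter> line u (rat_vec v) \<union> supp e' \<inter> line u (rat_vec v)"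
    by (auto simp: supp_def)
  then show "finite (supp (\<lambda>u. e u - e' u) \<inter> line u (rat_vec v))"
    using assms unfolding line_finite_def by (meson finite_UnI finite_subset)
qed

lemma line_finite_sum:
  assumes "finite J" "\<And>j. j \<in> J \<Longrightarrow> line_finite v (e j)"
  shows "line_finite v (\<lambda>u. \<Sum>j\<in>J. e j u)"
  unfolding line_finite_def
proof
  fix u
  have "supp (\<lambda>u. \<Sum>j\<in>J. e j u) \<inter> line u (rat_vec v) \<subseteq> (\<Union>j\<in>J. supp (e j) \<inter> line u (rat_vec v))"
    unfolding supp_def by (auto intro: ccontr sum.neutral)
  then show "finite (supp (\<lambda>u. \<Sum>j\<in>J. e j u) \<inter> line u (rat_vec v))"
    by (rule finite_subset) (use assms in \<open>simp add: line_finite_def del: UN_simps\<close>)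
qed

lemma few_lines_diff:
  assumes "few_lines v e" "few_lines v e'"
  shows "few_lines v (\<lambda>u. e u - e' u)"
proof -
  have "supp (\<lambda>u. e u - e' u) \<subseteq> supp e \<union> supp e'" by (auto simp: supp_def)
  then have "(\<lambda>u. line u (rat_vec v)) ` supp (\<lambda>u. e u - e' u)
      \<subseteq> (\<lambda>u. line u (rat_vec v)) ` supp e \<union> (\<lambda>u. line u (rat_vec v)) ` supp e'"
    by blast
  then show ?thesis
    using assms unfolding few_lines_def by (meson finite_UnI finite_subset)
qed

lemma few_lines_if_finite_sum:
  assumes "finite_sum_of_periodic_fibers (rat_vec v) c"
  shows "few_lines v c"
proof -
  obtain k e where e: "\<And>j. j < k \<Longrightarrow> fiber (rat_vec v) (e j)" and c: "c = (\<lambda>u. \<Sum>j<(k::nat). e j u)"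
    using assms unfolding finite_sum_of_periodic_fibers_def by blast
  obtain u where u: "\<And>j. j < k \<Longrightarrow> supp (e j) \<subseteq> line (u j) (rat_vec v)"
    using e unfolding fiber_def by metis
  have "(\<lambda>u. line u (rat_vec v)) ` supp c \<subseteq> (\<lambda>j. line (u j) (rat_vec v)) ` {..<k}"
  proof clarify
    fix x assume "x \<in> supp c"
    then have "\<exists>j<k. e j x \<noteq> 0"
      unfolding supp_def c by (metis (mono_tags, lifting) lessThan_iff mem_Collect_eq sum.neutral)
    then obtain j where "j < k" "x \<in> supp (e j)" by (auto simp: supp_def)
    with u line_eqI show "line x (rat_vec v) \<in> (\<lambda>j. line (u j) (rat_vec v)) ` {..<k}"
      by blast
  qed
  then show ?thesis unfolding few_lines_def by (rule finite_subset) simp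
qed

text \<open>Lines in non-parallel directions share at most one point, so a \<open>v'\<close>-line
  meets finitely many \<open>v\<close>-lines in finitely many points.\<close>

lemma few_lines_imp_line_finite:
  assumes D: "few_lines v D" and np: "\<not> parallel v v'"
  shows "line_finite v' D"
  unfolding line_finite_def
proof
  fix u
  have "inj_on (\<lambda>x. line x (rat_vec v)) (line u (rat_vec v'))"
  proof (rule inj_onI)
    fix x y assume xy: "x \<in> line u (rat_vec v')" "y \<in> line u (rat_vec v')"
      and eq: "line x (rat_vec v) = line y (rat_vec v)"
    obtain p where p: "rat_vec x = rat_vec y + p *s rat_vec v"
      using line_self[of x "rat_vec v"] unfolding eq unfolding line_def by blast
    obtain q where q: "rat_vec x = rat_vec y + q *s rat_vec v'"
      using xy(1) line_eqI[OF xy(2)] unfolding line_def by blast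
    have "p *s rat_vec v + (- q) *s rat_vec v' = 0"
      using p q by (simp add: vec_eq_iff)
    then have "p = 0" using np unfolding parallel_def by blast
    then show "x = y" using p by (simp add: rat_vec_inj)
  qed
  then have "inj_on (\<lambda>x. line x (rat_vec v)) (supp D \<inter> line u (rat_vec v'))"
    by (rule inj_on_subset) simp
  moreover have "finite ((\<lambda>x. line x (rat_vec v)) ` (supp D \<inter> line u (rat_vec v')))"
    using D unfolding few_lines_def by (rule finite_subset[rotated]) blast
  ultimately show "finite (supp D \<inter> line u (rat_vec v'))"
    by (rule finite_imageD[rotated])
qed

text \<open>A set of integers is finite exactly when it is bounded on both sides. This splits
  finiteness on lines into one condition for each end.\<close>

lemma line_finite_iff_ev_zero:
  assumes w: "w \<noteq> 0" "\<And>u. line u (rat_vec v) = range (\<lambda>k. u + k *s w)"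
  shows "line_finite v e \<longleftrightarrow> ev_zero w e \<and> ev_zero (- w) e"
proof (intro iffI conjI)
  assume lf: "line_finite v e"
  have "ev_zero x e" if x: "x = w \<or> x = - w" for x
    unfolding ev_zero_def
  proof
    fix u
    let ?S = "{k. e (u + int k *s x) \<noteq> 0}"
    have "(\<lambda>k. u + int k *s x) ` ?S \<subseteq> supp e \<inter> line u (rat_vec v)"
    proof clarify
      fix k assume "e (u + int k *s x) \<noteq> 0"
      moreover have "u + int k *s x = u + (if x = w then int k else - int k) *s w"
        using x by (auto simp: vec_eq_iff)
      then have "u + int k *s x \<in> range (\<lambda>k. u + k *s w)" by (rule range_eqI)
      ultimately show "u + int k *s x \<in> supp e \<inter> line u (rat_vec v)"
        by (simp add: supp_def w(2))
    qed
    then have "finite ((\<lambda>k. u + int k *s x) ` ?S)"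
      using lf unfolding line_finite_def by (meson finite_subset)
    moreover have "inj_on (\<lambda>k. u + int k *s x) ?S"
      using x w(1) by (auto simp: inj_on_def smult_eq_iff)
    ultimately have "finite ?S" by (rule finite_imageD)
    then show "\<forall>\<^sub>F k in sequentially. e (u + int k *s x) = 0"
      by (simp add: cofinite_eq_sequentially[symmetric] eventually_cofinite)
  qed
  then show "ev_zero w e" "ev_zero (- w) e" by auto
next
  assume ev: "ev_zero w e \<and> ev_zero (- w) e"
  show "line_finite v e"
    unfolding line_finite_def
  proof
    fix u
    have "\<forall>\<^sub>F k in sequentially. e (u + int k *s w) = 0 \<and> e (u + int k *s (- w)) = 0"
      using ev by (simp add: ev_zero_def eventually_conj)
    then obtain N where N: "\<And>k. k \<ge> N \<Longrightarrow> e (u + int k *s w) = 0 \<and> e (u + int k *s (- w)) = 0"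
      unfolding eventually_sequentially by blast
    have "supp e \<inter> line u (rat_vec v) \<subseteq> (\<lambda>k. u + k *s w) ` {- int N..int N}"
    proof
      fix x assume x: "x \<in> supp e \<inter> line u (rat_vec v)"
      then obtain k where k: "x = u + k *s w" by (auto simp: w(2))
      have "nat \<bar>k\<bar> < N"
      proof (rule ccontr)
        assume "\<not> nat \<bar>k\<bar> < N"
        then have "e (u + \<bar>k\<bar> *s w) = 0" "e (u + \<bar>k\<bar> *s (- w)) = 0"
          using N[of "nat \<bar>k\<bar>"] by auto
        moreover have "x = u + \<bar>k\<bar> *s w \<or> x = u + \<bar>k\<bar> *s (- w)"
          by (cases "k \<ge> 0") (auto simp: k vec_eq_iff)
        ultimately show False using x by (auto simp: supp_def)
      qed
      then show "x \<in> (\<lambda>k. u + k *s w) ` {- int N..int N}"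
        unfolding k by (intro imageI) auto
    qed
    then show "finite (supp e \<inter> line u (rat_vec v))"
      by (rule finite_subset) simp
  qed
qed

text \<open>The fibers are the restrictions of \<open>c\<close> to the lines that meet its support.
  Translation by \<open>x\<close> maps every line to itself, so each restriction inherits the period
  \<open>x\<close>.\<close>

lemma finite_sum_if_few_lines:
  assumes v: "v \<noteq> 0" and few: "few_lines v c"
    and x: "x \<noteq> 0" "\<And>u. c (u + x) = c u" "\<And>u. u + x \<in> line u (rat_vec v)"
  shows "finite_sum_of_periodic_fibers (rat_vec v) c"
proof -
  let ?L = "\<lambda>u. line u (rat_vec v)"
  \<comment> \<open>\<open>U\<close> holds one support point for each line, so no line is counted
    twice in the sum.\<close>
  obtain U where U: "U \<subseteq> supp c" "inj_on ?L U" "?L ` supp c = ?L ` U"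
    using subset_image_inj[of "?L ` supp c" ?L "supp c"] by auto
  have fin: "finite U"
    using few U by (simp add: few_lines_def finite_image_iff)
  obtain p where p: "bij_betw p {..<card U} U"
    using ex_bij_betw_nat_finite[OF fin] by (auto simp: lessThan_atLeast0)
  define e where "e j = (\<lambda>y. if y \<in> ?L (p j) then c y else 0)" for j
  have "fiber (rat_vec v) (e j)" for j
  proof -
    have "rat_vec v \<noteq> 0" using v rat_vec_inj[of v 0] by (simp add: rat_vec_def zero_vec_def)
    moreover have "supp (e j) \<subseteq> ?L (p j)" by (auto simp: supp_def e_def)
    ultimately show ?thesis unfolding fiber_def by blast
  qed
  moreover have "periodic (e j)" for j
  proof -
    have "u + x \<in> ?L z \<longleftrightarrow> u \<in> ?L z" for u z
      using line_eqI[of u z] line_eqI[of "u + x" z] x(3)[of u] line_eqI[OF x(3)[of u]] line_self by metis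
    then have "e j (u + x) = e j u" for u
      by (simp add: e_def x(2))
    then show ?thesis using x(1) unfolding periodic_def by blast
  qed
  moreover have "c = (\<lambda>y. \<Sum>j<card U. e j y)"
  proof
    fix y
    have "(\<Sum>j<card U. e j y) = (\<Sum>z\<in>U. if y \<in> ?L z then c y else 0)"
      unfolding e_def by (rule sum.reindex_bij_betw[OF p])
    also have "\<dots> = c y"
    proof (cases "c y = 0")
      case False
      then obtain z where z: "z \<in> U" "?L y = ?L z"
        using U(3) by (auto simp: supp_def set_eq_iff image_iff) metis
      have "y \<in> ?L z' \<longleftrightarrow> z' = z" if "z' \<in> U" for z'
        using that z U(2) line_eqI[of y z'] line_self[of y] by (metis inj_onD)
      then have "(\<Sum>z\<in>U. if y \<in> ?L z then c y else 0) = (\<Sum>z'\<in>U. if z' = z then c y else 0)"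
        by (intro sum.cong) auto
      then show ?thesis using fin z by simp
    qed (auto intro: sum.neutral)
    finally show "c y = (\<Sum>j<card U. e j y)" by simp
  qed
  ultimately show ?thesis
    unfolding finite_sum_of_periodic_fibers_def by blast
qed

text \<open>Factors are removed one at a time: the other factors preserve vanishing far out, so
  \<open>ev_zero_annihilated\<close> cancels \<open>f j\<close>. This serves both to compare the two
  ends of the lines and to show that the final remainder is zero.\<close>

lemma line_finite_annihilated:
  assumes "finite J" "\<And>j. j \<in> J \<Longrightarrow> line_polynomial (v j) (f j)" "\<And>j. j \<in> J \<Longrightarrow> line_finite (v j) e"
    and "act (\<Prod>j\<in>J. f j) e = (\<lambda>_. 0)"
  shows "e = (\<lambda>_. 0)"
  using assms
proof (induction J rule: finite_induct)
  case (insert j J)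
  obtain w where w: "w \<noteq> 0" "\<And>u. line u (rat_vec (v j)) = range (\<lambda>k. u + k *s w)"
    using line_param[of "v j"] insert.prems(1)[of j] by (auto simp: line_polynomial_def)
  obtain u0 d a where r: "recurrence w u0 d a (f j)"
    using line_polynomial_recurrence[OF insert.prems(1) w] by blast
  have "ev_zero w e"
    using insert.prems(2)[of j] line_finite_iff_ev_zero[OF w] by blast
  then have "ev_zero w (act (\<Prod>j\<in>J. f j) e)" by (rule ev_zero_act)
  moreover have "act (f j) (act (\<Prod>j\<in>J. f j) e) = (\<lambda>_. 0)"
    using insert by (simp add: act_mult)
  ultimately have "act (\<Prod>j\<in>J. f j) e = (\<lambda>_. 0)"
    using ev_zero_annihilated[OF r] by blast
  then show ?case using insert by blast
qed simp

section \<open>Periodic continuations of the ends of lines\<close>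

text \<open>\<open>b u\<close> is the value that \<open>c\<close> eventually takes along
  \<open>u\<close>, \<open>u + T w\<close>, \<open>u + 2 T w\<close> and so on. Periodicity and
  annihilation by \<open>f\<close> pass to this limit, and sparseness bounds the number of lines on
  which the limit is not zero.\<close>

lemma right_asymptotics:
  fixes c :: "int ^ 'd::finite \<Rightarrow> int"
  assumes r: "recurrence w u0 d a f" and w: "w \<noteq> 0"
    and c: "configuration c" "sparse c" and ev: "ev_zero w (act f c)"
  obtains b T where "T > 0" "\<And>u. b (u + int T *s w) = b u" "act f b = (\<lambda>_. 0)"
    "ev_zero w (\<lambda>u. b u - c u)" "finite ((\<lambda>u. range (\<lambda>k. u + k *s w)) ` supp b)"
proof -
  \<comment> \<open>\<open>T\<close> is fixed before the sequence \<open>s\<close>, so one period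
    serves all lines at once.\<close>
  obtain T where T: "T > 0"
    and per: "\<And>s. range s \<subseteq> range c \<Longrightarrow> \<forall>\<^sub>F n in sequentially. (\<Sum>k\<le>d. a k * s (n + d - k)) = 0 \<Longrightarrow>
       \<forall>\<^sub>F n in sequentially. s (n + T) = s n"
    using uniform_eventual_period[of "range c" a d] c(1) r
    by (auto simp: configuration_def recurrence_def)
  have cper: "\<forall>\<^sub>F n in sequentially. c (u + int (n + T) *s w) = c (u + int n *s w)" for u
  proof (rule per[of "\<lambda>n. c (u + int n *s w)"])
    \<comment> \<open>Starting at \<open>u0\<close> plus \<open>d\<close> steps of \<open>w\<close>
      matches the indices \<open>n + d - k\<close> of the recurrence.\<close>
    have "\<forall>\<^sub>F n in sequentially. act f c (u + int d *s w + u0 + int n *s w) = 0"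
      using ev by (simp add: ev_zero_def)
    then show "\<forall>\<^sub>F n in sequentially. (\<Sum>k\<le>d. a k * c (u + int (n + d - k) *s w)) = 0"
    proof eventually_elim
      case (elim n)
      have "act f c ((u + int (n + d) *s w) + u0) = (\<Sum>k\<le>d. a k * c (u + int (n + d) *s w - int k *s w))"
        using r by (simp only: recurrence_def)
      also have "\<dots> = (\<Sum>k\<le>d. a k * c (u + int (n + d - k) *s w))"
        by (intro sum.cong refl arg_cong2[where f = "(*)"] arg_cong[where f = c])
          (auto simp: vec_eq_iff of_nat_diff algebra_simps)
      finally show ?case
        using elim by (simp add: algebra_simps vector_sadd_rdistrib)
    qed
  qed auto
  have "\<exists>y. \<forall>\<^sub>F m in sequentially. c (u + int m *s (int T *s w)) = y" for u
  proof -
    obtain N where N: "\<And>n. n \<ge> N \<Longrightarrow> c (u + int (n + T) *s w) = c (u + int n *s w)"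
      using cper[of u] unfolding eventually_sequentially by blast
    \<comment> \<open>Both \<open>N * T\<close> and \<open>m * T\<close> are at least
      \<open>N\<close> and they differ by a multiple of \<open>T\<close>.\<close>
    have "c (u + int m *s (int T *s w)) = c (u + int (N * T) *s w)" if "m \<ge> N" for m
    proof -
      have "N * T \<ge> N" using T by simp
      moreover have "N * T + (m - N) * T = m * T"
        using that by (simp add: diff_mult_distrib)
      ultimately have "c (u + int (m * T) *s w) = c (u + int (N * T) *s w)"
        using periodic_mult[of N "\<lambda>n. c (u + int n *s w)" T "N * T" "m - N"] N by simp
      then show ?thesis by (simp add: vector_smult_assoc)
    qed
    then show ?thesis unfolding eventually_sequentially by blast
  qed
  then obtain b where b: "\<And>u. \<forall>\<^sub>F m in sequentially. c (u + int m *s (int T *s w)) = b u"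
    by metis
  have bI: "b u = y" if "\<forall>\<^sub>F m in sequentially. c (u + int m *s (int T *s w)) = y" for u y
  proof -
    have "\<forall>\<^sub>F m in sequentially. b u = y"
      using b[of u] that by eventually_elim simp
    then show ?thesis by simp
  qed
  have b_per: "b (u + int T *s w) = b u" for u
  proof (rule bI)
    have "\<forall>\<^sub>F m in sequentially. c (u + int (Suc m) *s (int T *s w)) = b u"
      using b[of u] by (subst eventually_sequentially_Suc)
    then show "\<forall>\<^sub>F m in sequentially. c (u + int T *s w + int m *s (int T *s w)) = b u"
      by eventually_elim (simp add: algebra_simps vector_sadd_rdistrib)
  qed
  have b_ann: "act f b = (\<lambda>_. 0)"
  proof
    fix u
    \<comment> \<open>Only finitely many values of \<open>b\<close> enter \<open>act f b u\<close>.
      Far enough out \<open>c\<close> takes all of them simultaneously, and there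
      \<open>act f c\<close> vanishes.\<close>
    have "\<forall>\<^sub>F m in sequentially. \<forall>x\<in>Poly_Mapping.keys f. c (u - x + int m *s (int T *s w)) = b (u - x)"
      using b by (intro eventually_ball_finite) auto
    then have "\<forall>\<^sub>F m in sequentially. act f b u = act f c (u + int m *s (int T *s w))"
      by eventually_elim (simp add: act_def algebra_simps)
    moreover have "\<forall>\<^sub>F m in sequentially. act f c (u + int m *s (int T *s w)) = 0"
    proof -
      obtain N where N: "\<And>n. n \<ge> N \<Longrightarrow> act f c (u + int n *s w) = 0"
        using ev unfolding ev_zero_def eventually_sequentially by blast
      have "act f c (u + int m *s (int T *s w)) = 0" if "m \<ge> N" for m
      proof -
        have "m * T \<ge> m" using T by simp
        then have "act f c (u + int (m * T) *s w) = 0"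
          using that by (intro N) linarith
        then show ?thesis by (simp add: vector_smult_assoc)
      qed
      then show ?thesis unfolding eventually_sequentially by blast
    qed
    ultimately have "\<forall>\<^sub>F m::nat in sequentially. act f b u = 0"
      by eventually_elim simp
    then show "act f b u = 0" by simp
  qed
  have b_ev: "ev_zero w (\<lambda>u. b u - c u)"
    unfolding ev_zero_def
  proof
    fix u
    obtain N where N: "\<And>n. n \<ge> N \<Longrightarrow> c (u + int (n + T) *s w) = c (u + int n *s w)"
      using cper[of u] unfolding eventually_sequentially by blast
    \<comment> \<open>From \<open>N\<close> on, \<open>c\<close> is already
      \<open>T\<close>-periodic on this ray, so the sequence whose limit defines \<open>b\<close> is
      constant from its first term.\<close>
    have "b (u + int n *s w) = c (u + int n *s w)" if "n \<ge> N" for n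
    proof (rule bI, rule always_eventually, rule)
      fix m
      have "c (u + int (n + m * T) *s w) = c (u + int n *s w)"
        using periodic_mult[of N "\<lambda>n. c (u + int n *s w)" T n m] N that by simp
      then show "c (u + int n *s w + int m *s (int T *s w)) = c (u + int n *s w)"
        by (simp add: vector_smult_assoc vector_sadd_rdistrib algebra_simps)
    qed
    then show "\<forall>\<^sub>F k in sequentially. b (u + int k *s w) - c (u + int k *s w) = 0"
      unfolding eventually_sequentially by auto
  qed
  let ?x = "int T *s w" and ?R = "\<lambda>u. range (\<lambda>k. u + k *s w)"
  obtain B :: nat where B: "\<And>S. finite S \<Longrightarrow> inj_on (\<lambda>(u, m). u + int m *s ?x) (S \<times> UNIV) \<Longrightarrow>
     (\<And>u. u \<in> S \<Longrightarrow> \<forall>\<^sub>F m in sequentially. c (u + int m *s ?x) \<noteq> 0) \<Longrightarrow> card S \<le> B"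
    using sparse_progressions[OF c(2)] by metis
  \<comment> \<open>A common bound for all finite families of lines gives finiteness. One base point
    on each line yields disjoint progressions, along which \<open>c\<close> is eventually the
    nonzero value \<open>b u\<close>.\<close>
  have "card F \<le> B" if F: "F \<subseteq> ?R ` supp b" "finite F" for F
  proof -
    obtain S where S: "S \<subseteq> supp b" "inj_on ?R S" "F = ?R ` S"
      using F(1) unfolding subset_image_inj by blast
    have R: "?R (u + k *s w) = ?R u" for u k
    proof -
      have "u + j *s w \<in> ?R (u + k *s w)" for j
        by (rule range_eqI[of _ _ "j - k"]) (simp add: vec_eq_iff algebra_simps)
      moreover have "u + k *s w + j *s w \<in> ?R u" for j
        by (rule range_eqI[of _ _ "k + j"]) (simp add: vec_eq_iff algebra_simps)
      ultimately show ?thesis by blast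
    qed
    have "card S \<le> B"
    proof (rule B)
      show "finite S" using F S by (simp add: finite_image_iff)
      show "inj_on (\<lambda>(u, m). u + int m *s ?x) (S \<times> UNIV)"
      proof (rule inj_onI, clarify)
        fix u u' m m' assume u: "u \<in> S" "u' \<in> S" and eq: "u + int m *s ?x = u' + int m' *s ?x"
        have "?R u = ?R u'"
          using R[of u "int m * int T"] R[of u' "int m' * int T"] eq by (simp add: vector_smult_assoc)
        then have "u = u'" using u S(2) by (auto dest: inj_onD)
        with eq show "u = u' \<and> m = m'"
          using w T by (simp add: vector_smult_assoc smult_eq_iff)
      qed
      fix u assume "u \<in> S"
      then have nz: "b u \<noteq> 0" using S(1) by (auto simp: supp_def)
      show "\<forall>\<^sub>F m in sequentially. c (u + int m *s ?x) \<noteq> 0"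
        using b[of u] by eventually_elim (simp add: nz)
    qed
    then show ?thesis using S by (simp add: card_image)
  qed
  then have "finite (?R ` supp b)"
    using finite_if_finite_subsets_card_bdd by blast
  with T b_per b_ann b_ev that show ?thesis by blast
qed

text \<open>The images under \<open>g\<close> of \<open>c\<close> and of the periodic continuations of its two ends are all
  annihilated by \<open>f\<close> and agree far out on every line, hence everywhere; as \<open>g\<close> is injective, the
  two continuations coincide.\<close>

lemma asymptotic_part:
  fixes c :: "int ^ 'd::finite \<Rightarrow> int"
  assumes f: "line_polynomial v f" and c: "configuration c" "sparse c"
    and lf: "line_finite v (act f c)" and g: "act g (act f c) = (\<lambda>_. 0)"
    and inj: "\<And>e. few_lines v e \<Longrightarrow> act g e = (\<lambda>_. 0) \<Longrightarrow> e = (\<lambda>_. 0)"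
  obtains b where "finite_sum_of_periodic_fibers (rat_vec v) b" "act f b = (\<lambda>_. 0)"
    "line_finite v (\<lambda>u. c u - b u)"
proof -
  have v: "v \<noteq> 0" using f by (simp add: line_polynomial_def)
  obtain w where w: "w \<noteq> 0" "\<And>u. line u (rat_vec v) = range (\<lambda>k. u + k *s w)"
    using line_param[OF v] by blast
  \<comment> \<open>The opposite generator describes the same lines, which lets
    \<open>right_asymptotics\<close> treat the left ends as well.\<close>
  have w': "- w \<noteq> 0" "\<And>u. line u (rat_vec v) = range (\<lambda>k. u + k *s (- w))"
  proof -
    have "range (\<lambda>k. u + k *s w) = range (\<lambda>k. u + k *s (- w))" for u
    proof -
      have "(\<lambda>k. u + k *s (- w)) = (\<lambda>k. u + k *s w) \<circ> uminus"
        by (auto simp: vec_eq_iff)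
      then show ?thesis by (metis image_comp surj_uminus)
    qed
    with w show "- w \<noteq> 0" "\<And>u. line u (rat_vec v) = range (\<lambda>k. u + k *s (- w))" by auto
  qed
  obtain u0 d a where r: "recurrence w u0 d a f"
    using line_polynomial_recurrence[OF f w] by blast
  note r' = recurrence_uminus[OF r]
  have ev: "ev_zero w (act f c)" "ev_zero (- w) (act f c)"
    using lf line_finite_iff_ev_zero[OF w] by auto
  obtain b T where b: "T > 0" "\<And>u. b (u + int T *s w) = b u" "act f b = (\<lambda>_. 0)"
    "ev_zero w (\<lambda>u. b u - c u)" "few_lines v b"
    using right_asymptotics[OF r w(1) c ev(1)] unfolding few_lines_def w(2) by blast
  obtain b' where b': "act f b' = (\<lambda>_. 0)" "ev_zero (- w) (\<lambda>u. b' u - c u)" "few_lines v b'"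
    using right_asymptotics[OF r' w'(1) c ev(2)] unfolding few_lines_def w'(2) by blast
  have g_eq: "act g e = act g c"
    if "recurrence x y d a' f" "act f e = (\<lambda>_. 0)" "ev_zero x (\<lambda>u. e u - c u)" for e x y a'
  proof -
    have "act f (act g (\<lambda>u. e u - c u)) = act g (act f (\<lambda>u. e u - c u))"
      by (simp add: act_mult[symmetric] mult.commute)
    also have "\<dots> = (\<lambda>_. 0)"
      by (simp only: act_diff that(2) g act_zero diff_self)
    finally have "act g (\<lambda>u. e u - c u) = (\<lambda>_. 0)"
      using ev_zero_annihilated[OF that(1)] ev_zero_act[OF that(3)] by blast
    then show ?thesis by (auto simp: act_diff fun_eq_iff)
  qed
  have "act g (\<lambda>u. b u - b' u) = (\<lambda>_. 0)"
    using g_eq[OF r b(3,4)] g_eq[OF r' b'(1,2)] by (simp add: act_diff)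
  then have "(\<lambda>u. b u - b' u) = (\<lambda>_. 0)"
    using inj few_lines_diff[OF b(5) b'(3)] by blast
  then have "b = b'" by (auto simp: fun_eq_iff)
  then have "ev_zero (- w) (\<lambda>u. b u - c u)" using b'(2) by simp
  moreover have "c x - b x = 0 \<longleftrightarrow> b x - c x = 0" for x by auto
  ultimately have "ev_zero w (\<lambda>u. c u - b u)" "ev_zero (- w) (\<lambda>u. c u - b u)"
    using b(4) by (simp_all only: ev_zero_def simp_thms)
  then have "line_finite v (\<lambda>u. c u - b u)"
    using line_finite_iff_ev_zero[OF w] by blast
  moreover have "finite_sum_of_periodic_fibers (rat_vec v) b"
  proof (rule finite_sum_if_few_lines[OF v b(5)])
    show "int T *s w \<noteq> 0" using b(1) w(1) smult_eq_iff[OF w(1), of "int T" 0] by simp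
    show "u + int T *s w \<in> line u (rat_vec v)" for u unfolding w(2) by (rule rangeI)
  qed (rule b(2))
  ultimately show ?thesis using that b(3) by blast
qed

section \<open>The decomposition, by induction on the set of factors\<close>

text \<open>Stated for an arbitrary finite index set because the induction hypothesis is applied to
  \<open>I - {i}\<close> for every \<open>i\<close> in turn, and for arbitrary \<open>c\<close>
  because it is applied to \<open>act (f i) c\<close>.\<close>

lemma sparse_decomposition:
  fixes c :: "int ^ 'd::finite \<Rightarrow> int"
  assumes "finite I" "configuration c" "sparse c"
    and "\<And>i. i \<in> I \<Longrightarrow> line_polynomial (v i) (f i)"
    and "\<And>i j. i \<in> I \<Longrightarrow> j \<in> I \<Longrightarrow> i \<noteq> j \<Longrightarrow> \<not> parallel (v i) (v j)"
    and "act (\<Prod>i\<in>I. f i) c = (\<lambda>_. 0)"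
  shows "\<exists>b. c = (\<lambda>u. \<Sum>i\<in>I. b i u) \<and>
    (\<forall>i\<in>I. finite_sum_of_periodic_fibers (rat_vec (v i)) (b i) \<and> act (f i) (b i) = (\<lambda>_. 0))"
  using assms
proof (induction I arbitrary: c rule: finite_psubset_induct)
  case (psubset I)
  note lp = psubset.prems(3) and np = psubset.prems(4)
  have "\<exists>b. finite_sum_of_periodic_fibers (rat_vec (v i)) b \<and> act (f i) b = (\<lambda>_. 0) \<and>
    line_finite (v i) (\<lambda>u. c u - b u)" if i: "i \<in> I" for i
  proof -
    let ?J = "I - {i}"
    let ?g = "\<Prod>j\<in>?J. f j"
    have g: "act ?g (act (f i) c) = (\<lambda>_. 0)"
      using psubset.prems(5) act_prod_split[OF psubset.hyps(1) i, of f c] by simp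
    \<comment> \<open>This splits \<open>act (f i) c\<close> into fibers in directions not parallel
      to \<open>v i\<close>, each of which meets a \<open>v i\<close>-line in at most one point;
      hence \<open>act (f i) c\<close> is finite on these lines.\<close>
    have "\<exists>b. act (f i) c = (\<lambda>u. \<Sum>j\<in>?J. b j u) \<and>
      (\<forall>j\<in>?J. finite_sum_of_periodic_fibers (rat_vec (v j)) (b j) \<and> act (f j) (b j) = (\<lambda>_. 0))"
      by (rule psubset.IH)
        (use i lp np g psubset.prems(1,2) in \<open>auto intro: configuration_act sparse_act\<close>)
    then obtain b where b: "act (f i) c = (\<lambda>u. \<Sum>j\<in>?J. b j u)"
      "\<And>j. j \<in> ?J \<Longrightarrow> finite_sum_of_periodic_fibers (rat_vec (v j)) (b j)"
      by blast
    have lf: "line_finite (v i) (b j)" if "j \<in> ?J" for j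
      using few_lines_imp_line_finite[OF few_lines_if_finite_sum[OF b(2)[OF that]]] np i that by blast
    have "line_finite (v i) (act (f i) c)"
      unfolding b(1) using psubset.hyps(1) lf by (intro line_finite_sum) auto
    \<comment> \<open>Injectivity of the other factors on functions carried by finitely many
      \<open>v i\<close>-lines: such a function is finite on the lines of every other
      direction.\<close>
    moreover have "e = (\<lambda>_. 0)" if "few_lines (v i) e" "act ?g e = (\<lambda>_. 0)" for e
      by (rule line_finite_annihilated[OF _ _ _ that(2)])
        (use psubset.hyps(1) lp np i few_lines_imp_line_finite[OF that(1)] in auto)
    ultimately show ?thesis
      using asymptotic_part[OF lp[OF i] psubset.prems(1,2) _ g] by metis
  qed
  then obtain b where b: "\<And>i. i \<in> I \<Longrightarrow> finite_sum_of_periodic_fibers (rat_vec (v i)) (b i)"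
    "\<And>i. i \<in> I \<Longrightarrow> act (f i) (b i) = (\<lambda>_. 0)"
    "\<And>i. i \<in> I \<Longrightarrow> line_finite (v i) (\<lambda>u. c u - b i u)"
    by metis
  define e where "e = (\<lambda>u. c u - (\<Sum>i\<in>I. b i u))"
  have "e = (\<lambda>_. 0)"
  proof (rule line_finite_annihilated[OF psubset.hyps(1) lp])
    \<comment> \<open>On \<open>v i\<close>-lines, \<open>c\<close> minus \<open>b i\<close> is
      finite by the choice of \<open>b i\<close>, and the remaining \<open>b j\<close> live on
      finitely many lines in other directions.\<close>
    show "line_finite (v i) e" if i: "i \<in> I" for i
    proof -
      have lf: "line_finite (v i) (b j)" if "j \<in> I - {i}" for j
        using few_lines_imp_line_finite[OF few_lines_if_finite_sum[OF b(1)]] np i that by blast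
      have "line_finite (v i) (\<lambda>u. \<Sum>j\<in>I - {i}. b j u)"
        using psubset.hyps(1) lf by (intro line_finite_sum) auto
      moreover have "e = (\<lambda>u. c u - b i u - (\<Sum>j\<in>I - {i}. b j u))"
        using psubset.hyps(1) i by (simp add: e_def sum.remove algebra_simps)
      ultimately show ?thesis
        using line_finite_diff[OF b(3)[OF i]] by simp
    qed
    \<comment> \<open>The factor \<open>f i\<close> alone annihilates \<open>b i\<close>, so the
      whole product annihilates every summand and with it the remainder \<open>e\<close>.\<close>
    have "act (\<Prod>i\<in>I. f i) (b i) = (\<lambda>_. 0)" if "i \<in> I" for i
      using act_prod_split[OF psubset.hyps(1) that, of f "b i"] b(2)[OF that] by simp
    then show "act (\<Prod>i\<in>I. f i) e = (\<lambda>_. 0)"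
      using psubset.prems(5) by (simp add: e_def act_diff act_sum)
  qed
  then have "c = (\<lambda>u. \<Sum>i\<in>I. b i u)"
    by (auto simp: e_def fun_eq_iff)
  with b show ?case by blast
qed

theorem theorem4:
  fixes c :: "int ^ 'd::finite \<Rightarrow> int"
    and n :: nat
    and \<phi> :: "nat \<Rightarrow> 'd laurent"
    and v :: "nat \<Rightarrow> int ^ 'd"
  assumes "configuration c"
    and "sparse c"
    and "\<And>i. i \<in> {1..n} \<Longrightarrow> line_polynomial (v i) (\<phi> i)"
    and "\<And>i j. i \<in> {1..n} \<Longrightarrow> j \<in> {1..n} \<Longrightarrow> i \<noteq> j \<Longrightarrow> \<not> parallel (v i) (v j)"
    and "act (\<Prod>i\<in>{1..n}. \<phi> i) c = (\<lambda>_. 0)"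
  shows "\<exists>cs :: nat \<Rightarrow> int ^ 'd \<Rightarrow> int.
           c = (\<lambda>u. \<Sum>i\<in>{1..n}. cs i u) \<and>
           (\<forall>i\<in>{1..n}. finite_sum_of_periodic_fibers (rat_vec (v i)) (cs i)
                        \<and> act (\<phi> i) (cs i) = (\<lambda>_. 0))"
  by (rule sparse_decomposition[OF finite_atLeastAtMost assms])

end
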